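(* Let $X$ be a geodesically complete proper CAT(0) space and $G<\mathrm{Is}(X)$ a totally disconnected closed subgroup acting minimally on $X$. Then the pointwise stabiliser in $G$ of every bounded subset of $X$ is open in $G$.
   Context: A metric space is proper if all its closed balls are compact. $\mathrm{Is}(X)$ is the full isometry group of $X$, with the topology of uniform convergence on compacta. A CAT(0) space is geodesically complete if every geodesic segment of positive length can be extended to a bi-infinite geodesic line. An isometric action of a group $G$ on $X$ is minimal if there is no non-empty $G$-invariant closed convex subset $X'\subsetneq X$. *)

theory Defs
  imports "HOL-Analysis.Analysis" "HOL-Algebra.Group"
begin

text \<open>A metric space \<open>X\<close> is a type of class \<open>metric_space\<close>; properties of the space itself are
  predicates on its type.\<close>

definition proper_space :: "'a::metric_space itself \<Rightarrow> bool" where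
  "proper_space TYPE('a) \<longleftrightarrow> (\<forall>(x::'a) r. compact (cball x r))"

subsection \<open>Geodesics and CAT(0) spaces\<close>

definition isometric_on :: "real set \<Rightarrow> (real \<Rightarrow> 'a::metric_space) \<Rightarrow> bool" where
  "isometric_on I c \<longleftrightarrow> (\<forall>s\<in>I. \<forall>t\<in>I. dist (c s) (c t) = \<bar>s - t\<bar>)"

text \<open>A geodesic segment is the image of a geodesic; its length is then the distance of its
  endpoints.\<close>

definition geodesic_segment :: "'a::metric_space \<Rightarrow> 'a \<Rightarrow> 'a set \<Rightarrow> bool" where
  "geodesic_segment x y S \<longleftrightarrow>
     (\<exists>c l. 0 \<le> l \<and> isometric_on {0..l} c \<and> c 0 = x \<and> c l = y \<and> S = c ` {0..l})"

definition geodesic_line :: "(real \<Rightarrow> 'a::metric_space) \<Rightarrow> bool" where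
  "geodesic_line c \<longleftrightarrow> isometric_on UNIV c"

definition geodesic_space :: "'a::metric_space itself \<Rightarrow> bool" where
  "geodesic_space TYPE('a) \<longleftrightarrow> (\<forall>x y::'a. \<exists>S. geodesic_segment x y S)"

definition geodesically_complete :: "'a::metric_space itself \<Rightarrow> bool" where
  "geodesically_complete TYPE('a) \<longleftrightarrow>
     (\<forall>(x::'a) y S. geodesic_segment x y S \<and> x \<noteq> y \<longrightarrow> (\<exists>c. geodesic_line c \<and> S \<subseteq> range c))"

definition geodesic_triangle ::
    "'a::metric_space \<Rightarrow> 'a \<Rightarrow> 'a \<Rightarrow> 'a set \<Rightarrow> 'a set \<Rightarrow> 'a set \<Rightarrow> bool" where
  "geodesic_triangle p q r P Q R \<longleftrightarrow>
     geodesic_segment p q P \<and> geodesic_segment q r Q \<and> geodesic_segment r p R"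

definition comparison_triangle ::
    "'a::metric_space \<Rightarrow> 'a \<Rightarrow> 'a \<Rightarrow> real^2 \<Rightarrow> real^2 \<Rightarrow> real^2 \<Rightarrow> bool" where
  "comparison_triangle p q r p' q' r' \<longleftrightarrow>
     dist p' q' = dist p q \<and> dist q' r' = dist q r \<and> dist r' p' = dist r p"

text \<open>\<open>x'\<close> is the comparison point, on the Euclidean segment from \<open>p'\<close> to \<open>q'\<close>, of the point
  \<open>x\<close> of the side \<open>S\<close> from \<open>p\<close> to \<open>q\<close>.\<close>

definition comparison_point ::
    "'a::metric_space \<Rightarrow> 'a set \<Rightarrow> real^2 \<Rightarrow> real^2 \<Rightarrow> 'a \<Rightarrow> real^2 \<Rightarrow> bool" where
  "comparison_point p S p' q' x x' \<longleftrightarrow>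
     x \<in> S \<and> x' \<in> closed_segment p' q' \<and> dist p' x' = dist p x"

definition CAT0_space :: "'a::metric_space itself \<Rightarrow> bool" where
  "CAT0_space TYPE('a) \<longleftrightarrow>
     geodesic_space TYPE('a) \<and>
     (\<forall>(p::'a) q r P Q R p' q' r'.
        geodesic_triangle p q r P Q R \<and> comparison_triangle p q r p' q' r' \<longrightarrow>
        (let cmp = (\<lambda>x x'. comparison_point p P p' q' x x' \<or>
                           comparison_point q Q q' r' x x' \<or>
                           comparison_point r R r' p' x x')
         in \<forall>x y x' y'. cmp x x' \<and> cmp y y' \<longrightarrow> dist x y \<le> dist x' y'))"

definition geodesically_convex :: "'a::metric_space set \<Rightarrow> bool" where
  "geodesically_convex C \<longleftrightarrow> (\<forall>x\<in>C. \<forall>y\<in>C. \<forall>S. geodesic_segment x y S \<longrightarrow> S \<subseteq> C)"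

subsection \<open>The isometry group\<close>

definition Isom :: "('a::metric_space \<Rightarrow> 'a) set" where
  "Isom = {g. surj g \<and> (\<forall>x y. dist (g x) (g y) = dist x y)}"

definition isometry_group :: "('a::metric_space \<Rightarrow> 'a) monoid" where
  "isometry_group = \<lparr>carrier = Isom, mult = (\<circ>), one = id\<rparr>"

lemma group_isometry_group: "group (isometry_group :: ('a::metric_space \<Rightarrow> 'a) monoid)"
proof (rule groupI)
  fix g :: "'a \<Rightarrow> 'a"
  assume "g \<in> carrier isometry_group"
  then have s: "surj g" and d: "\<And>x y. dist (g x) (g y) = dist x y"
    by (auto simp: isometry_group_def Isom_def)
  have inj: "inj g"
    by (rule injI) (metis d dist_eq_0_iff)
  have "inv_into UNIV g \<in> Isom"
    unfolding Isom_def using s inj by (auto simp: inj_imp_surj_inv) (metis d surj_f_inv_f)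
  then show "\<exists>h\<in>carrier isometry_group. h \<otimes>\<^bsub>isometry_group\<^esub> g = \<one>\<^bsub>isometry_group\<^esub>"
    using inj by (auto simp: isometry_group_def intro!: bexI[of _ "inv_into UNIV g"])
qed (auto simp: isometry_group_def Isom_def comp_assoc surj_def, metis)

text \<open>The topology of uniform convergence on compacta on the full isometry group.\<close>

definition isometry_topology :: "('a::metric_space \<Rightarrow> 'a) topology" where
  "isometry_topology = topology (\<lambda>U. U \<subseteq> Isom \<and>
     (\<forall>g\<in>U. \<exists>K e. compact K \<and> e > 0 \<and> {h \<in> Isom. \<forall>x\<in>K. dist (g x) (h x) < e} \<subseteq> U))"

lemma openin_isometry_topology:
  "openin isometry_topology U \<longleftrightarrow> U \<subseteq> Isom \<and>
     (\<forall>g\<in>U. \<exists>K e. compact K \<and> e > 0 \<and> {h \<in> Isom. \<forall>x\<in>K. dist (g x) (h x) < e} \<subseteq> U)"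
  for U :: "('a::metric_space \<Rightarrow> 'a) set"
proof -
  let ?N = "\<lambda>(g::'a \<Rightarrow> 'a) K e. {h \<in> Isom. \<forall>x\<in>K. dist (g x) (h x) < (e::real)}"
  let ?P = "\<lambda>U. U \<subseteq> Isom \<and> (\<forall>g\<in>U. \<exists>K e. compact K \<and> e > 0 \<and> ?N g K e \<subseteq> U)"
  have "istopology ?P"
    unfolding istopology_def
  proof (intro conjI allI impI)
    fix S T assume S: "?P S" and T: "?P T"
    show "S \<inter> T \<subseteq> Isom" using S by blast
    show "\<forall>g\<in>S \<inter> T. \<exists>K e. compact K \<and> e > 0 \<and> ?N g K e \<subseteq> S \<inter> T"
    proof
      fix g assume g: "g \<in> S \<inter> T"
      obtain K e where 1: "compact K" "e > 0" "?N g K e \<subseteq> S" using S g by blast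
      obtain L f where 2: "compact L" "f > 0" "?N g L f \<subseteq> T" using T g by blast
      have "?N g (K \<union> L) (min e f) \<subseteq> S \<inter> T" using 1(3) 2(3) by auto
      moreover have "compact (K \<union> L)" "min e f > 0" using 1 2 by auto
      ultimately show "\<exists>K e. compact K \<and> e > 0 \<and> ?N g K e \<subseteq> S \<inter> T" by blast
    qed
  next
    fix \<K> assume K: "\<forall>S\<in>\<K>. ?P S"
    show "\<Union>\<K> \<subseteq> Isom" using K by blast
    show "\<forall>g\<in>\<Union>\<K>. \<exists>K e. compact K \<and> e > 0 \<and> ?N g K e \<subseteq> \<Union>\<K>"
    proof
      fix g assume "g \<in> \<Union>\<K>"
      then obtain S where S: "S \<in> \<K>" "g \<in> S" by blast
      then obtain K e where "compact K" "e > 0" "?N g K e \<subseteq> S" using K by meson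
      with S show "\<exists>K e. compact K \<and> e > 0 \<and> ?N g K e \<subseteq> \<Union>\<K>" by blast
    qed
  qed
  then show ?thesis
    unfolding isometry_topology_def by (simp add: topology_inverse')
qed

lemma topspace_isometry_topology [simp]:
  "topspace isometry_topology = (Isom :: ('a::metric_space \<Rightarrow> 'a) set)"
proof -
  have "openin isometry_topology (Isom :: ('a \<Rightarrow> 'a) set)"
    unfolding openin_isometry_topology
    by (intro conjI ballI exI[of _ "{}"] exI[of _ 1]) auto
  moreover have "topspace isometry_topology \<subseteq> (Isom :: ('a \<Rightarrow> 'a) set)"
    using openin_topspace openin_isometry_topology by blast
  ultimately show ?thesis by (simp add: openin_subset subset_antisym)
qed

definition totally_disconnected_space :: "'a topology \<Rightarrow> bool" where
  "totally_disconnected_space T \<longleftrightarrow>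
     (\<forall>x\<in>topspace T. connected_component_of_set T x = {x})"

definition minimal_action :: "('a::metric_space \<Rightarrow> 'a) set \<Rightarrow> bool" where
  "minimal_action G \<longleftrightarrow>
     \<not> (\<exists>X'. X' \<noteq> {} \<and> X' \<subset> UNIV \<and> closed X' \<and> geodesically_convex X' \<and> (\<forall>g\<in>G. g ` X' = X'))"

definition pointwise_stabiliser :: "('a \<Rightarrow> 'a) set \<Rightarrow> 'a set \<Rightarrow> ('a \<Rightarrow> 'a) set" where
  "pointwise_stabiliser G B = {g \<in> G. \<forall>x\<in>B. g x = x}"

end

theory Submission
  imports Defs
begin

text \<open>By van Dantzig's theorem \<open>G\<close> has an open subgroup with a bounded orbit, and that subgroup fixes
  the circumcentre of the orbit. So the set of points with open stabiliser is non-empty; it is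
  \<open>G\<close>-invariant and convex, hence dense by minimality. Finitely many of its points form a 1-net of a
  given ball, and their common stabiliser \<open>U\<close> is open. The fixed point set of \<open>U\<close> contains the
  ball of radius one less: otherwise project a missing point \<open>x\<close> to \<open>p\<close> in the fixed point set and extend the
  geodesic from \<open>p\<close> through \<open>x\<close> to a point \<open>y\<close> at distance 1 from \<open>p\<close>; then \<open>p\<close> is also the
  projection of \<open>y\<close>, so \<open>y\<close> has distance 1 from the fixed point set, contradicting the net.\<close>

section \<open>CAT(0) geometry\<close>

text \<open>Fixing the length as \<open>dist x y\<close> lets a point of a segment be named by its
  distance from \<open>x\<close>. Values outside \<open>{0..dist x y}\<close> are free, so a
  geodesic line can itself serve as a path.\<close>

definition geodesic_path :: "'a::metric_space \<Rightarrow> 'a \<Rightarrow> (real \<Rightarrow> 'a) \<Rightarrow> bool" where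
  "geodesic_path x y c \<longleftrightarrow> isometric_on {0..dist x y} c \<and> c 0 = x \<and> c (dist x y) = y"

lemma geodesic_path_dist:
  assumes "geodesic_path x y c" "s \<in> {0..dist x y}" "t \<in> {0..dist x y}"
  shows "dist (c s) (c t) = \<bar>s - t\<bar>"
  using assms unfolding geodesic_path_def isometric_on_def by blast

lemma geodesic_segment_iff_path:
  "geodesic_segment x y S \<longleftrightarrow> (\<exists>c. geodesic_path x y c \<and> S = c ` {0..dist x y})"
proof
  assume "geodesic_segment x y S"
  then obtain c l where c: "0 \<le> l" "isometric_on {0..l} c" "c 0 = x" "c l = y" "S = c ` {0..l}"
    unfolding geodesic_segment_def by blast
  then have "dist (c 0) (c l) = \<bar>0 - l\<bar>"
    unfolding isometric_on_def by (metis atLeastAtMost_iff order_refl)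
  then have "dist x y = l" using c by simp
  then show "\<exists>c. geodesic_path x y c \<and> S = c ` {0..dist x y}"
    using c unfolding geodesic_path_def by blast
next
  assume "\<exists>c. geodesic_path x y c \<and> S = c ` {0..dist x y}"
  then show "geodesic_segment x y S"
    unfolding geodesic_segment_def geodesic_path_def by (metis zero_le_dist)
qed

lemma CAT0_geodesic_path:
  assumes "CAT0_space TYPE('a::metric_space)"
  obtains c where "geodesic_path (x::'a) y c"
  using assms unfolding CAT0_space_def geodesic_space_def geodesic_segment_iff_path by blast

lemma geodesically_convexD:
  assumes "geodesically_convex C" "x \<in> C" "y \<in> C" "geodesic_path x y c" "t \<in> {0..dist x y}"
  shows "c t \<in> C"
  using assms unfolding geodesically_convex_def geodesic_segment_iff_path by blast

section \<open>Comparison triangles and the CAT(0) inequality\<close>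

text \<open>\<open>CAT0_space\<close> quantifies over given comparison triangles, so one has to be
  built: \<open>p'\<close> is the origin, \<open>q'\<close> lies on the first axis, and the law of
  cosines gives the foot \<open>u\<close> and the height \<open>v\<close> of
  \<open>r'\<close>.\<close>

lemma comparison_triangle_exists:
  obtains p' q' r' where "comparison_triangle p q r p' q' r'"
proof -
  define a b c where "a = dist p q" and "b = dist q r" and "c = dist r p"
  have nn: "0 \<le> a" "0 \<le> b" "0 \<le> c" by (auto simp: a_def b_def c_def)
  have tri: "a \<le> b + c" "b \<le> a + c" "c \<le> a + b"
    unfolding a_def b_def c_def by metric+
  \<comment> \<open>For \<open>a = 0\<close> the triangle inequalities force \<open>b = c\<close>,
    and \<open>u = c\<close> puts \<open>r'\<close> on the axis at height zero.\<close>
  define u where "u = (if a = 0 then c else (a\<^sup>2 + c\<^sup>2 - b\<^sup>2) / (2 * a))"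
  define v where "v = sqrt (c\<^sup>2 - u\<^sup>2)"
  have ac: "2 * a * u = a\<^sup>2 + c\<^sup>2 - b\<^sup>2"
    using tri by (auto simp: u_def field_simps)
  have "u\<^sup>2 \<le> c\<^sup>2"
  proof (cases "a = 0")
    case False
    then have "0 < a" using nn by simp
    have "b\<^sup>2 \<le> (a + c)\<^sup>2" using tri nn by (simp add: power_mono)
    then have 1: "2 * a * (- c) \<le> 2 * a * u" unfolding ac by (simp add: power2_eq_square algebra_simps)
    have "(a - c)\<^sup>2 \<le> b\<^sup>2" using tri nn by (intro abs_le_square_iff[THEN iffD1]) auto
    then have 2: "2 * a * u \<le> 2 * a * c" unfolding ac by (simp add: power2_eq_square algebra_simps)
    have "- c \<le> u" "u \<le> c"
      using 1 2 \<open>0 < a\<close> by (simp_all only: mult_le_cancel_left_pos zero_less_mult_iff zero_less_numeral simp_thms)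
    then show ?thesis by (intro abs_le_square_iff[THEN iffD1]) auto
  qed (simp add: u_def)
  then have v: "v\<^sup>2 = c\<^sup>2 - u\<^sup>2" unfolding v_def by simp
  define p' q' r' :: "real^2" where "p' = vector [0, 0]" and "q' = vector [a, 0]" and "r' = vector [u, v]"
  have "dist p' q' = a"
    using nn by (simp add: p'_def q'_def dist_vec_def L2_set_def sum_2 dist_real_def)
  moreover have "dist r' p' = c"
    using nn v by (simp add: p'_def r'_def dist_vec_def L2_set_def sum_2 dist_real_def)
  moreover have "(a - u)\<^sup>2 + v\<^sup>2 = b\<^sup>2"
    using ac unfolding v by (simp add: power2_eq_square algebra_simps)
  then have "dist q' r' = b"
    using nn by (simp add: q'_def r'_def dist_vec_def L2_set_def sum_2 dist_real_def)
  ultimately show thesis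
    by (intro that[of p' q' r']) (simp add: comparison_triangle_def a_def b_def c_def)
qed

text \<open>Stewart's theorem, an equality in Euclidean space.\<close>

lemma dist_convex_combination_square:
  fixes p q z :: "'b::real_inner"
  shows "(dist z (p + s *\<^sub>R (q - p)))\<^sup>2 =
    (1 - s) * (dist z p)\<^sup>2 + s * (dist z q)\<^sup>2 - s * (1 - s) * (dist p q)\<^sup>2"
  by (simp add: dist_norm power2_norm_eq_inner inner_diff_left inner_diff_right inner_add_left
      inner_add_right inner_commute algebra_simps)

text \<open>Comparing the vertex \<open>z\<close> with a point of the opposite side turns Stewart's
  equality into an inequality. For \<open>s = 1/2\<close> it is the Bruhat-Tits inequality. Every
  later use of curvature goes through it.\<close>

lemma CAT0_stewart:
  assumes C: "CAT0_space TYPE('a::metric_space)"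
    and c: "geodesic_path (x::'a) y c" and s: "0 \<le> s" "s \<le> 1"
  shows "(dist z (c (s * dist x y)))\<^sup>2 \<le>
    (1 - s) * (dist z x)\<^sup>2 + s * (dist z y)\<^sup>2 - s * (1 - s) * (dist x y)\<^sup>2"
proof -
  let ?P = "c ` {0..dist x y}" and ?t = "s * dist x y"
  have t: "?t \<in> {0..dist x y}" using s by (simp add: mult_left_le_one_le)
  obtain p' q' z' where T: "comparison_triangle x y z p' q' z'"
    by (rule comparison_triangle_exists)
  have "\<forall>u v::'a. \<exists>S. geodesic_segment u v S"
    using C unfolding CAT0_space_def geodesic_space_def by (rule conjunct1)
  then obtain Q R where QR: "geodesic_segment y z Q" "geodesic_segment z x R" by blast
  have tri: "geodesic_triangle x y z ?P Q R"
    unfolding geodesic_triangle_def using c QR geodesic_segment_iff_path by blast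
  define x' where "x' = p' + s *\<^sub>R (q' - p')"
  have d: "dist p' q' = dist x y" "dist z' p' = dist z x" "dist z' q' = dist z y"
    using T by (auto simp: comparison_triangle_def dist_commute)
  have "dist x (c ?t) = ?t"
    using geodesic_path_dist[OF c _ t, of 0] c s by (auto simp: geodesic_path_def)
  moreover have "dist p' x' = ?t"
    using s d(1) by (simp add: x'_def dist_norm norm_minus_commute)
  moreover have "x' \<in> closed_segment p' q'"
    unfolding closed_segment_def x'_def using s by (auto simp: algebra_simps intro!: exI[of _ s])
  ultimately have 1: "comparison_point x ?P p' q' (c ?t) x'"
    unfolding comparison_point_def using t by auto
  \<comment> \<open>The vertex \<open>z\<close> counts as the initial point of the third
    side.\<close>
  have 2: "comparison_point z R z' p' z z'"
    using QR(2) unfolding comparison_point_def geodesic_segment_def by auto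
  have "dist z (c ?t) \<le> dist z' x'"
    using C tri T 1 2 unfolding CAT0_space_def Let_def by blast
  then have "(dist z (c ?t))\<^sup>2 \<le> (dist z' x')\<^sup>2" by (simp add: power_mono)
  then show ?thesis unfolding x'_def dist_convex_combination_square d .
qed

text \<open>\<open>c' t\<close> has the same distances to \<open>x\<close> and \<open>y\<close> as
  \<open>c t\<close>, and for such a point the bound in Stewart's inequality is zero.\<close>

lemma CAT0_geodesic_path_unique:
  assumes C: "CAT0_space TYPE('a::metric_space)"
    and c: "geodesic_path (x::'a) y c" and c': "geodesic_path x y c'" and t: "t \<in> {0..dist x y}"
  shows "c t = c' t"
proof (cases "dist x y = 0")
  case True
  then show ?thesis using c c' t by (simp add: geodesic_path_def)
next
  case False
  define s where "s = t / dist x y"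
  have s: "0 \<le> s" "s \<le> 1" "t = s * dist x y" using t False by (auto simp: s_def field_simps)
  have d: "dist (c' t) x = s * dist x y" "dist (c' t) y = (1 - s) * dist x y"
    using geodesic_path_dist[OF c' t, of 0] geodesic_path_dist[OF c' t, of "dist x y"] c' t s(3)
    by (auto simp: geodesic_path_def algebra_simps)
  have "(dist (c' t) (c t))\<^sup>2 \<le> (1 - s) * (s * dist x y)\<^sup>2 + s * ((1 - s) * dist x y)\<^sup>2
      - s * (1 - s) * (dist x y)\<^sup>2"
    using CAT0_stewart[OF C c s(1,2), of "c' t"] by (simp only: d s(3)[symmetric])
  also have "\<dots> = 0" by (simp add: power2_eq_square algebra_simps)
  finally show ?thesis by simp
qed

text \<open>Approximate the endpoints from \<open>K\<close> and divide the approximating geodesics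
  in the ratio of \<open>w\<close>. By Stewart's inequality the squared distances to
  \<open>w\<close> are at most \<open>b n\<close>, which tends to 0.\<close>

lemma geodesically_convex_closure:
  assumes C: "CAT0_space TYPE('a::metric_space)" and K: "geodesically_convex (K :: 'a set)"
  shows "geodesically_convex (closure K)"
  unfolding geodesically_convex_def
proof (intro ballI allI impI subsetI)
  fix x y S w
  assume x: "x \<in> closure K" and y: "y \<in> closure K" and "geodesic_segment x y S" "w \<in> S"
  then obtain c t where c: "geodesic_path x y c" and t: "t \<in> {0..dist x y}" "w = c t"
    unfolding geodesic_segment_iff_path by blast
  show "w \<in> closure K"
  proof (cases "dist x y = 0")
    case True
    then show ?thesis using c t x by (simp add: geodesic_path_def)
  next
    case False
    define s where "s = t / dist x y"
    have s: "0 \<le> s" "s \<le> 1" "t = s * dist x y" using t False by (auto simp: s_def field_simps)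
    have wd: "dist w x = s * dist x y" "dist w y = (1 - s) * dist x y"
      using geodesic_path_dist[OF c t(1), of 0] geodesic_path_dist[OF c t(1), of "dist x y"] c t s(3)
      by (auto simp: geodesic_path_def algebra_simps)
    obtain u v where u: "\<And>n. u n \<in> K" "u \<longlonglongrightarrow> x" and v: "\<And>n. v n \<in> K" "v \<longlonglongrightarrow> y"
      using x y unfolding closure_sequential by blast
    have "\<exists>e. geodesic_path (u n) (v n) e" for n
      by (meson C CAT0_geodesic_path)
    then obtain e where e: "\<And>n. geodesic_path (u n) (v n) (e n)" by metis
    define z where "z n = e n (s * dist (u n) (v n))" for n
    define b where "b n = (1 - s) * (dist w (u n))\<^sup>2 + s * (dist w (v n))\<^sup>2
      - s * (1 - s) * (dist (u n) (v n))\<^sup>2" for n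
    have zK: "z n \<in> K" for n
      unfolding z_def using s
      by (intro geodesically_convexD[OF K u(1) v(1) e]) (simp add: mult_left_le_one_le)
    have "b \<longlonglongrightarrow> (1 - s) * (dist w x)\<^sup>2 + s * (dist w y)\<^sup>2 - s * (1 - s) * (dist x y)\<^sup>2"
      unfolding b_def by (intro tendsto_intros u v)
    then have "b \<longlonglongrightarrow> 0" unfolding wd by (simp add: power2_eq_square algebra_simps)
    moreover have "(dist w (z n))\<^sup>2 \<le> b n" for n
      unfolding b_def z_def by (rule CAT0_stewart[OF C e s(1,2)])
    then have "\<forall>\<^sub>F n in sequentially. norm ((dist w (z n))\<^sup>2) \<le> b n" by simp
    ultimately have "(\<lambda>n. (dist w (z n))\<^sup>2) \<longlonglongrightarrow> 0"
      by (metis (no_types) Lim_null_comparison)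
    then have "(\<lambda>n. dist (z n) w) \<longlonglongrightarrow> 0"
      using tendsto_real_sqrt by (fastforce simp: dist_commute)
    then have "z \<longlonglongrightarrow> w" by (rule iffD2[OF tendsto_dist_iff])
    then show ?thesis unfolding closure_sequential using zK by blast
  qed
qed

text \<open>The fixed point is the circumcentre of \<open>S\<close>.\<close>

lemma CAT0_bounded_set_center:
  assumes C: "CAT0_space TYPE('a::metric_space)" and P: "proper_space TYPE('a)"
    and B: "bounded (S :: 'a set)" "S \<noteq> {}"
  obtains z where "\<And>g. g \<in> Isom \<Longrightarrow> g ` S = S \<Longrightarrow> g z = z"
proof -
  \<comment> \<open>\<open>R z\<close> is the radius of the smallest closed ball about
    \<open>z\<close> containing \<open>S\<close>; the circumcentre minimises it.\<close>
  define R where "R z = (SUP s\<in>S. dist z s)" for z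
  have bdd: "bdd_above ((\<lambda>s. dist z s) ` S)" for z
    using B(1) unfolding bounded_any_center[of _ z] bdd_above_def by auto
  have le: "dist z s \<le> R z" if "s \<in> S" for z s
    unfolding R_def by (rule cSUP_upper[OF that bdd])
  have least: "R z \<le> b" if "\<And>s. s \<in> S \<Longrightarrow> dist z s \<le> b" for z b
    unfolding R_def by (rule cSUP_least[OF B(2) that])
  have lip: "R z \<le> R w + dist z w" for z w
  proof (rule least)
    fix s assume "s \<in> S"
    then show "dist z s \<le> R w + dist z w"
      using le[of s w] dist_triangle[of z s w] by simp
  qed
  have "dist (R z) (R w) \<le> dist z w" for z w
    using lip[of z w] lip[of w z] by (simp add: dist_real_def dist_commute abs_le_iff)
  then have cont: "continuous_on X R" for X
    unfolding continuous_on_iff by (metis le_less_trans)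
  obtain s0 where s0: "s0 \<in> S" using B by blast
  \<comment> \<open>Outside this ball the distance to \<open>s0\<close> alone exceeds
    \<open>R s0\<close>, so a minimum over the ball is global.\<close>
  have "compact (cball s0 (R s0))" using P by (simp add: proper_space_def)
  moreover have "0 \<le> R s0" using le[OF s0, of s0] by simp
  ultimately obtain m where m: "\<And>z. z \<in> cball s0 (R s0) \<Longrightarrow> R m \<le> R z"
    using continuous_attains_inf[of "cball s0 (R s0)" R] cont by (metis centre_in_cball empty_iff)
  have min: "R m \<le> R z" for z
  proof (cases "z \<in> cball s0 (R s0)")
    case False
    then have "R s0 < R z" using le[OF s0, of z] by (simp add: dist_commute)
    then show ?thesis using m[of s0] \<open>0 \<le> R s0\<close> by simp
  qed (rule m)
  have unique: "m' = m" if eq: "R m' = R m" for m'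
  proof (rule ccontr)
    assume "m' \<noteq> m"
    then have l: "0 < dist m m'" by simp
    obtain c where c: "geodesic_path m m' c" by (rule CAT0_geodesic_path[OF C])
    \<comment> \<open>The midpoint of two distinct minimisers would have a strictly smaller
      radius.\<close>
    define w where "w = c ((1/2) * dist m m')"
    have "R w \<le> sqrt ((R m)\<^sup>2 - (dist m m')\<^sup>2 / 4)"
    proof (rule least)
      fix s assume s: "s \<in> S"
      have "(dist s w)\<^sup>2 \<le> (dist s m)\<^sup>2 / 2 + (dist s m')\<^sup>2 / 2 - (dist m m')\<^sup>2 / 4"
        using CAT0_stewart[OF C c, of "1/2" s] unfolding w_def by simp
      moreover have "(dist s m)\<^sup>2 \<le> (R m)\<^sup>2" "(dist s m')\<^sup>2 \<le> (R m)\<^sup>2"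
        using le[OF s, of m] le[OF s, of m'] eq by (simp_all add: dist_commute power_mono)
      ultimately show "dist w s \<le> sqrt ((R m)\<^sup>2 - (dist m m')\<^sup>2 / 4)"
        by (intro real_le_rsqrt) (simp add: dist_commute)
    qed
    moreover have "0 \<le> R m" using le[OF s0, of m] zero_le_dist[of m s0] by linarith
    then have "sqrt ((R m)\<^sup>2 - (dist m m')\<^sup>2 / 4) < R m"
    proof -
      have "(dist m m')\<^sup>2 > 0" using l by simp
      then have "sqrt ((R m)\<^sup>2 - (dist m m')\<^sup>2 / 4) < sqrt ((R m)\<^sup>2)"
        by (intro real_sqrt_less_mono) linarith
      then show ?thesis using \<open>0 \<le> R m\<close> by simp
    qed
    ultimately show False using min[of w] by simp
  qed
  show thesis
  proof (rule that)
    fix g :: "'a \<Rightarrow> 'a"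
    assume g: "g \<in> Isom" "g ` S = S"
    have "R (g m) = (SUP s\<in>g ` S. dist (g m) s)" unfolding R_def g ..
    also have "\<dots> = R m" using g(1) by (simp add: R_def image_image Isom_def)
    finally show "g m = m" by (rule unique)
  qed
qed

section \<open>Projection to closed convex sets\<close>

text \<open>Only points of \<open>K\<close> at most as far from \<open>x\<close> as some
  \<open>q0\<close> compete, and these form a compact set.\<close>

lemma proper_closest_point:
  assumes P: "proper_space TYPE('a::metric_space)" and K: "closed (K :: 'a set)" "K \<noteq> {}"
  obtains p where "p \<in> K" "\<And>q. q \<in> K \<Longrightarrow> dist p x \<le> dist q x"
proof -
  obtain q0 where q0: "q0 \<in> K" using K by blast
  have "compact (K \<inter> cball x (dist q0 x))"
    using P K by (auto simp: proper_space_def)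
  moreover have "q0 \<in> K \<inter> cball x (dist q0 x)" using q0 by (simp add: dist_commute)
  moreover have "continuous_on (K \<inter> cball x (dist q0 x)) (\<lambda>q. dist q x)"
    by (intro continuous_intros)
  ultimately obtain p where p: "p \<in> K \<inter> cball x (dist q0 x)"
      "\<And>q. q \<in> K \<inter> cball x (dist q0 x) \<Longrightarrow> dist p x \<le> dist q x"
    using continuous_attains_inf[of "K \<inter> cball x (dist q0 x)" "\<lambda>q. dist q x"] by blast
  show thesis
  proof (rule that)
    fix q assume "q \<in> K"
    then show "dist p x \<le> dist q x"
      using p by (cases "dist q x \<le> dist q0 x") (auto simp: dist_commute)
  qed (use p in blast)
qed

text \<open>If \<open>p\<close> is the point of \<open>K\<close> closest to some interior point \<open>c t\<close> of the geodesic, then the angle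
  at \<open>p\<close> with any direction into \<open>K\<close> is at least a right angle; hence \<open>p\<close> is also closest to \<open>y\<close>.\<close>

lemma CAT0_closest_point_extend:
  assumes C: "CAT0_space TYPE('a::metric_space)" and K: "geodesically_convex (K :: 'a set)"
    and p: "p \<in> K" and c: "geodesic_path p y c" and t: "0 < t" "t \<le> dist p y"
    and min: "\<And>q. q \<in> K \<Longrightarrow> dist p (c t) \<le> dist q (c t)" and q: "q \<in> K"
  shows "dist p y \<le> dist q y"
proof (rule ccontr)
  assume "\<not> ?thesis"
  then have less: "dist q y < dist p y" by simp
  obtain e where e: "geodesic_path p q e" by (rule CAT0_geodesic_path[OF C])
  define L D d \<tau> where "L = dist p y" and "D = dist p q" and "d = dist q y" and "\<tau> = t / L"
  have L: "0 < L" using t unfolding L_def by linarith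
  have \<tau>: "0 < \<tau>" "\<tau> \<le> 1" "t = \<tau> * dist p y" using t L by (auto simp: \<tau>_def L_def)
  have px: "dist p (c t) = \<tau> * L"
    using geodesic_path_dist[OF c, of 0 t] t c \<tau>(3) by (auto simp: geodesic_path_def L_def)
  \<comment> \<open>A first variation: moving from \<open>p\<close> by the fraction \<open>s\<close>
    towards \<open>q\<close> does not approach \<open>c t\<close>. Stewart's inequality is applied
    to the geodesic from \<open>p\<close> to \<open>q\<close> seen from \<open>y\<close>, then to
    the one from \<open>p\<close> to \<open>y\<close> seen from \<open>?q\<close>. After division by
    \<open>s\<close>, the limit at 0 yields
    \<open>L\<^sup>2 + D\<^sup>2 \<le> d\<^sup>2\<close>.\<close>
  have ineq: "0 \<le> (1 - \<tau>) * s * D\<^sup>2 + \<tau> * (d\<^sup>2 - L\<^sup>2 - (1 - s) * D\<^sup>2)" if s: "0 < s" "s \<le> 1" for s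
  proof -
    let ?q = "e (s * dist p q)"
    have qK: "?q \<in> K"
      using s by (intro geodesically_convexD[OF K p q e]) (simp add: mult_left_le_one_le)
    have 1: "(dist y ?q)\<^sup>2 \<le> (1 - s) * L\<^sup>2 + s * d\<^sup>2 - s * (1 - s) * D\<^sup>2"
      using CAT0_stewart[OF C e, of s y] s by (simp add: L_def d_def D_def dist_commute)
    have 2: "dist ?q p = s * D"
      using geodesic_path_dist[OF e, of "s * dist p q" 0] e s
      by (auto simp: geodesic_path_def D_def mult_left_le_one_le)
    have "(\<tau> * L)\<^sup>2 \<le> (dist ?q (c t))\<^sup>2"
      using min[OF qK] px L \<tau> by (intro power_mono) auto
    also have "\<dots> \<le> (1 - \<tau>) * (s * D)\<^sup>2 + \<tau> * (dist y ?q)\<^sup>2 - \<tau> * (1 - \<tau>) * L\<^sup>2"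
      using CAT0_stewart[OF C c, of \<tau> ?q] \<tau> 2 by (simp add: L_def dist_commute)
    also have "\<dots> \<le> (1 - \<tau>) * (s * D)\<^sup>2 + \<tau> * ((1 - s) * L\<^sup>2 + s * d\<^sup>2 - s * (1 - s) * D\<^sup>2)
        - \<tau> * (1 - \<tau>) * L\<^sup>2"
      using mult_left_mono[OF 1, of \<tau>] \<tau> by simp
    finally have "0 \<le> s * ((1 - \<tau>) * s * D\<^sup>2 + \<tau> * (d\<^sup>2 - L\<^sup>2 - (1 - s) * D\<^sup>2))"
      by (simp add: power2_eq_square algebra_simps)
    then show ?thesis using s by (simp add: zero_le_mult_iff)
  qed
  have "((\<lambda>s. (1 - \<tau>) * s * D\<^sup>2 + \<tau> * (d\<^sup>2 - L\<^sup>2 - (1 - s) * D\<^sup>2)) \<longlongrightarrow>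
      (1 - \<tau>) * 0 * D\<^sup>2 + \<tau> * (d\<^sup>2 - L\<^sup>2 - (1 - 0) * D\<^sup>2)) (at_right 0)"
    by (intro tendsto_intros)
  moreover have "eventually (\<lambda>s. 0 \<le> (1 - \<tau>) * s * D\<^sup>2 + \<tau> * (d\<^sup>2 - L\<^sup>2 - (1 - s) * D\<^sup>2)) (at_right 0)"
    using ineq by (auto simp: eventually_at_right_field intro!: exI[of _ 1])
  ultimately have "0 \<le> (1 - \<tau>) * 0 * D\<^sup>2 + \<tau> * (d\<^sup>2 - L\<^sup>2 - (1 - 0) * D\<^sup>2)"
    by (rule tendsto_lowerbound) simp
  then have "0 \<le> d\<^sup>2 - L\<^sup>2 - D\<^sup>2" using \<tau> by (simp add: zero_le_mult_iff)
  then have "L\<^sup>2 \<le> d\<^sup>2" using zero_le_power2[of D] by linarith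
  then have "L \<le> d" by (rule power2_le_imp_le) (simp add: d_def)
  then show False using less by (simp add: L_def d_def)
qed

lemma geodesically_complete_line_through:
  assumes C: "CAT0_space TYPE('a::metric_space)" and E: "geodesically_complete TYPE('a)"
    and "(p::'a) \<noteq> x"
  obtains c where "geodesic_line c" "c 0 = p" "c (dist p x) = x"
proof -
  obtain e where "geodesic_path p x e" by (rule CAT0_geodesic_path[OF C])
  then have "geodesic_segment p x (e ` {0..dist p x})" and e: "e 0 = p" "e (dist p x) = x"
    unfolding geodesic_segment_iff_path geodesic_path_def by blast+
  then obtain f where f: "geodesic_line f" "e ` {0..dist p x} \<subseteq> range f"
    using E \<open>p \<noteq> x\<close> unfolding geodesically_complete_def by blast
  have "e 0 \<in> range f" "e (dist p x) \<in> range f" using f(2) by (simp_all add: image_subset_iff)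
  then obtain a b where ab: "p = f a" "x = f b" unfolding e by blast
  then have d: "dist p x = \<bar>a - b\<bar>" using f(1) by (simp add: geodesic_line_def isometric_on_def)
  \<comment> \<open>The line may run from \<open>x\<close> to \<open>p\<close>; the sign
    \<open>\<sigma>\<close> then reverses it.\<close>
  define \<sigma> where "\<sigma> = (if a \<le> b then 1 else - 1 :: real)"
  have "\<bar>\<sigma> * s - \<sigma> * t\<bar> = \<bar>s - t\<bar>" for s t by (auto simp: \<sigma>_def)
  then have "geodesic_line (\<lambda>t. f (a + \<sigma> * t))"
    using f(1) by (auto simp: geodesic_line_def isometric_on_def)
  moreover have "a + \<sigma> * dist p x = b" unfolding d \<sigma>_def by auto
  ultimately show thesis by (intro that[of "\<lambda>t. f (a + \<sigma> * t)"]) (auto simp: ab)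
qed

text \<open>The projection argument. A point \<open>x\<close> of the ball outside \<open>K\<close>
  would yield \<open>c 1\<close>, at distance at least 1 from every point of \<open>K\<close>. Since
  \<open>c 1\<close> lies within 1 of \<open>x\<close>, \<open>near\<close> is required on radius
  \<open>r + 1\<close>.\<close>

lemma convex_meeting_unit_balls_contains_cball:
  assumes C: "CAT0_space TYPE('a::metric_space)" and P: "proper_space TYPE('a)"
    and E: "geodesically_complete TYPE('a)"
    and K: "closed K" "geodesically_convex (K :: 'a set)"
    and near: "\<And>y. y \<in> cball a (r + 1) \<Longrightarrow> \<exists>q\<in>K. dist q y < 1"
  shows "cball a r \<subseteq> K"
proof (rule subsetI, rule ccontr)
  fix x assume x: "x \<in> cball a r" "x \<notin> K"
  then have "x \<in> cball a (r + 1)" by simp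
  then obtain q where q: "q \<in> K" "dist q x < 1" using near by blast
  then obtain p where p: "p \<in> K" "\<And>q. q \<in> K \<Longrightarrow> dist p x \<le> dist q x"
    using proper_closest_point[OF P K(1), of x] by blast
  then have "p \<noteq> x" using x by blast
  have "dist p x < 1" using p(2)[OF q(1)] q(2) by simp
  obtain c where c: "geodesic_line c" "c 0 = p" "c (dist p x) = x"
    by (rule geodesically_complete_line_through[OF C E \<open>p \<noteq> x\<close>])
  have cd: "dist (c s) (c t) = \<bar>s - t\<bar>" for s t
    using c(1) by (simp add: geodesic_line_def isometric_on_def)
  have py: "dist p (c 1) = 1" using cd[of 0 1] c by simp
  have path: "geodesic_path p (c 1) c"
    using c cd py by (simp add: geodesic_path_def isometric_on_def)
  have "dist x (c 1) \<le> 1" using cd[of "dist p x" 1] c \<open>dist p x < 1\<close> by simp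
  then have "c 1 \<in> cball a (r + 1)" using x dist_triangle[of a "c 1" x] by simp
  then obtain q' where q': "q' \<in> K" "dist q' (c 1) < 1" using near by blast
  have "dist p (c 1) \<le> dist q' (c 1)"
    using CAT0_closest_point_extend[OF C K(2) p(1) path, of "dist p x" q'] \<open>p \<noteq> x\<close> \<open>dist p x < 1\<close> py c(3) p(2) q'(1)
    by simp
  then show False using q' py by simp
qed

section \<open>Fixed point sets\<close>

text \<open>An isometry fixing both endpoints carries the geodesic to one with the same endpoints,
  hence to itself. \<open>U\<close> is any set of isometries; later it is a neighbourhood of the
  identity in \<open>G\<close>.\<close>

lemma closed_geodesically_convex_fixed_points:
  assumes C: "CAT0_space TYPE('a::metric_space)" and U: "U \<subseteq> (Isom :: ('a \<Rightarrow> 'a) set)"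
  shows "closed {x. \<forall>g\<in>U. g x = x}" "geodesically_convex {x. \<forall>g\<in>U. g x = x}"
proof -
  have d: "dist (g x) (g y) = dist x y" if "g \<in> U" for g x y
    using that U unfolding Isom_def by blast
  have "closed {x. g x = x}" if "g \<in> U" for g
  proof -
    have "continuous_on UNIV g" unfolding continuous_on_iff using d[OF that] by auto
    then show ?thesis by (intro closed_Collect_eq continuous_on_id)
  qed
  then have "closed (\<Inter>g\<in>U. {x. g x = x})" by blast
  also have "(\<Inter>g\<in>U. {x. g x = x}) = {x. \<forall>g\<in>U. g x = x}" by blast
  finally show "closed {x. \<forall>g\<in>U. g x = x}" .
  show "geodesically_convex {x. \<forall>g\<in>U. g x = x}"
    unfolding geodesically_convex_def
  proof (intro ballI allI impI subsetI)
    fix x y S w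
    assume xy: "x \<in> {x. \<forall>g\<in>U. g x = x}" "y \<in> {x. \<forall>g\<in>U. g x = x}"
      and "geodesic_segment x y S" "w \<in> S"
    then obtain c t where c: "geodesic_path x y c" and t: "t \<in> {0..dist x y}" "w = c t"
      unfolding geodesic_segment_iff_path by blast
    have "g w = w" if g: "g \<in> U" for g
    proof -
      have "geodesic_path x y (g \<circ> c)"
        using c xy g d[OF g] by (auto simp: geodesic_path_def isometric_on_def)
      then have "(g \<circ> c) t = c t" by (rule CAT0_geodesic_path_unique[OF C _ c t(1)])
      then show ?thesis by (simp add: t(2))
    qed
    then show "w \<in> {x. \<forall>g\<in>U. g x = x}" by blast
  qed
qed

section \<open>Isometry groups with pointwise convergence\<close>

lemma Isom_iff: "g \<in> Isom \<longleftrightarrow> surj g \<and> (\<forall>x y. dist (g x) (g y) = dist x y)"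
  by (simp add: Isom_def)

lemma Isom_bij: "g \<in> Isom \<Longrightarrow> bij g"
  unfolding Isom_iff bij_def inj_def by (metis dist_eq_0_iff)

lemma compact_finite_net:
  fixes K :: "'a::metric_space set"
  assumes "compact K" "e > 0"
  obtains N where "finite N" "N \<subseteq> K" "\<And>x. x \<in> K \<Longrightarrow> \<exists>n\<in>N. dist n x < e"
proof -
  have "K \<subseteq> (\<Union>x\<in>K. ball x e)" using assms by auto
  then obtain N where "N \<subseteq> K" "finite N" "K \<subseteq> (\<Union>x\<in>N. ball x e)"
    using compactE_image[OF assms(1), of K "\<lambda>x. ball x e"] by auto
  then show thesis by (intro that[of N]) (auto simp: subset_iff)
qed

text \<open>On a function type \<open>open\<close> refers to the product topology, that is, to
  pointwise convergence.\<close>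

lemma open_fun_near_on_finite:
  fixes g :: "'a \<Rightarrow> 'b::metric_space"
  assumes "finite N"
  shows "open {h. \<forall>n\<in>N. dist (g n) (h n) < e}"
  using product_topology_basis'[OF assms, of "\<lambda>n. ball (g n) e" "\<lambda>n. n"] by simp

lemma open_fun_near_on_finiteE:
  fixes g :: "'a \<Rightarrow> 'b::metric_space"
  assumes "open W" "g \<in> W"
  obtains N e where "finite N" "e > 0" "\<And>h. (\<forall>n\<in>N. dist (g n) (h n) < e) \<Longrightarrow> h \<in> W"
proof -
  obtain X where X: "finite {i. X i \<noteq> UNIV}" "\<And>i. open (X i)" "g \<in> Pi\<^sub>E UNIV X" "Pi\<^sub>E UNIV X \<subseteq> W"
    using assms unfolding open_fun_def openin_product_topology_alt by fastforce
  have "\<exists>e>0. ball (g i) e \<subseteq> X i" for i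
    using X(2,3) open_contains_ball by (metis PiE_mem UNIV_I)
  then obtain e where e: "\<And>i. e i > (0::real)" "\<And>i. ball (g i) (e i) \<subseteq> X i" by metis
  \<comment> \<open>The element 1 keeps \<open>Min\<close> meaningful when no coordinate is
    restricted.\<close>
  define d where "d = Min (insert 1 (e ` {i. X i \<noteq> UNIV}))"
  have d: "0 < d" "\<And>i. X i \<noteq> UNIV \<Longrightarrow> d \<le> e i"
    unfolding d_def using X(1) e(1) by auto
  show thesis
  proof (rule that[OF X(1) d(1)])
    fix h assume h: "\<forall>n\<in>{i. X i \<noteq> UNIV}. dist (g n) (h n) < d"
    have "h i \<in> X i" for i
    proof (cases "X i = UNIV")
      case False
      then have "dist (g i) (h i) < e i" using h d(2)[of i] by (auto intro: less_le_trans)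
      then show ?thesis using e(2)[of i] by (auto simp: subset_iff)
    qed simp
    then show "h \<in> W" using X(4) by (auto simp: subset_iff PiE_iff)
  qed
qed

text \<open>Isometries are 1-Lipschitz, so closeness on a finite \<open>e / 3\<close>-net of a
  compact set gives closeness on the whole set. This makes the product topology and Tychonoff's
  theorem available.\<close>

lemma isometry_topology_eq:
  "isometry_topology = top_of_set (Isom :: ('a::metric_space \<Rightarrow> 'a) set)"
  unfolding topology_eq
proof (intro allI iffI)
  fix U :: "('a \<Rightarrow> 'a) set"
  assume "openin (top_of_set Isom) U"
  then obtain W where W: "open W" "U = Isom \<inter> W" unfolding openin_open by blast
  show "openin isometry_topology U"
    unfolding openin_isometry_topology
  proof (intro conjI ballI)
    fix g assume "g \<in> U"
    then obtain N e where "finite N" "e > 0" "\<And>h. (\<forall>n\<in>N. dist (g n) (h n) < e) \<Longrightarrow> h \<in> W"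
      using open_fun_near_on_finiteE[OF W(1)] W(2) by blast
    then show "\<exists>K e. compact K \<and> e > 0 \<and> {h \<in> Isom. \<forall>x\<in>K. dist (g x) (h x) < e} \<subseteq> U"
      using W(2) finite_imp_compact by (intro exI[of _ N] exI[of _ e]) auto
  qed (use W in blast)
next
  fix U :: "('a \<Rightarrow> 'a) set"
  assume U: "openin isometry_topology U"
  then have U_Isom: "U \<subseteq> Isom" unfolding openin_isometry_topology by blast
  have "\<exists>W. open W \<and> g \<in> W \<and> Isom \<inter> W \<subseteq> U" if g: "g \<in> U" for g
  proof -
    have gI: "g \<in> Isom" using U_Isom g by blast
    obtain K e where K: "compact K" "e > 0" "{h \<in> Isom. \<forall>x\<in>K. dist (g x) (h x) < e} \<subseteq> U"
      using U g unfolding openin_isometry_topology by meson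
    obtain N where N: "finite N" "\<And>x. x \<in> K \<Longrightarrow> \<exists>n\<in>N. dist n x < e / 3"
      using compact_finite_net[OF K(1), of "e / 3"] K(2) by (metis zero_less_divide_iff zero_less_numeral)
    let ?W = "{h. \<forall>n\<in>N. dist (g n) (h n) < e / 3}"
    have "h \<in> U" if h: "h \<in> Isom" "h \<in> ?W" for h
    proof -
      have "dist (g x) (h x) < e" if x: "x \<in> K" for x
      proof -
        obtain n where n: "n \<in> N" "dist n x < e / 3" using N(2) x by blast
        have "dist (g x) (h x) \<le> dist (g x) (g n) + dist (g n) (h n) + dist (h n) (h x)"
          using dist_triangle[of "g x" "h x" "g n"] dist_triangle[of "g n" "h x" "h n"] by linarith
        also have "\<dots> = dist x n + dist (g n) (h n) + dist n x"
          using gI h(1) by (simp add: Isom_iff)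
        also have "\<dots> < e" using n h(2) by (simp add: dist_commute) force
        finally show ?thesis .
      qed
      then show ?thesis using K(3) h(1) by blast
    qed
    moreover have "open ?W" by (rule open_fun_near_on_finite[OF N(1)])
    ultimately show ?thesis using K(2) by (intro exI[of _ ?W]) auto
  qed
  then obtain W where W: "\<And>g. g \<in> U \<Longrightarrow> open (W g)" "\<And>g. g \<in> U \<Longrightarrow> g \<in> W g"
    "\<And>g. g \<in> U \<Longrightarrow> Isom \<inter> W g \<subseteq> U" by metis
  have "U = Isom \<inter> (\<Union>g\<in>U. W g)"
  proof (intro equalityI subsetI IntI UN_I)
    show "h \<in> U" if "h \<in> Isom \<inter> (\<Union>g\<in>U. W g)" for h using that W(3) by blast
  qed (use U_Isom W(2) in blast)+
  moreover have "open (\<Union>g\<in>U. W g)" using W(1) by (rule open_UN[OF ballI])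
  ultimately show "openin (top_of_set Isom) U" by (metis openin_open_Int)
qed

text \<open>Arzela-Ascoli for isometries: by Tychonoff's theorem only closedness in the space of all maps
  is at stake, and surjectivity survives pointwise limits because balls are compact.\<close>

lemma compact_Isom_bounded_displacement:
  assumes P: "proper_space TYPE('a::metric_space)"
  shows "compact {h \<in> Isom. dist (h a) (a::'a) \<le> r}" (is "compact ?S")
proof -
  let ?K = "Pi\<^sub>E UNIV (\<lambda>x. cball a (r + dist a x))"
  have "compact ?K"
    using P compactin_PiE[of "\<lambda>_. euclidean" UNIV "\<lambda>x. cball a (r + dist a x)"]
    by (simp add: euclidean_product_topology proper_space_def)
  moreover have "?S \<subseteq> ?K"
  proof
    fix h assume "h \<in> ?S"
    then have h: "\<And>x y. dist (h x) (h y) = dist x y" "dist (h a) a \<le> r" by (auto simp: Isom_iff)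
    have "dist a (h x) \<le> r + dist a x" for x
      using dist_triangle[of a "h x" "h a"] h(1)[of a x] h(2) by (simp add: dist_commute)
    then show "h \<in> ?K" by auto
  qed
  moreover have "closed ?S"
  proof -
    have "f \<in> ?S" if f: "f \<in> closure ?S" for f
    proof -
      have ev: "continuous_on UNIV (\<lambda>h::'a \<Rightarrow> 'a. h x)" for x by simp
      have "closed {h::'a \<Rightarrow> 'a. dist (h x) (h y) = dist x y}" for x y
        by (intro closed_Collect_eq continuous_intros ev)
      then have "closure ?S \<subseteq> {h. dist (h x) (h y) = dist x y}" for x y
        by (intro closure_minimal) (auto simp: Isom_iff)
      then have d: "dist (f x) (f y) = dist x y" for x y using f by blast
      have "closed {h::'a \<Rightarrow> 'a. dist (h a) a \<le> r}"
        by (intro closed_Collect_le continuous_intros ev)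
      then have "closure ?S \<subseteq> {h. dist (h a) a \<le> r}"
        by (intro closure_minimal) auto
      then have r: "dist (f a) a \<le> r" using f by blast
      have "y \<in> range f" for y
      proof -
        let ?B = "cball a (r + dist a y)"
        have B: "compact ?B" using P by (simp add: proper_space_def)
        have "continuous_on ?B f" unfolding continuous_on_iff using d by auto
        then have "closed (f ` ?B)" using B compact_continuous_image compact_imp_closed by blast
        \<comment> \<open>Take \<open>h\<close> in \<open>?S\<close> close to \<open>f\<close> on a
          net of \<open>?B\<close>. The preimage of \<open>y\<close> under \<open>h\<close> stays in
          \<open>?B\<close>, and \<open>f\<close> sends a net point near it to within
          \<open>e\<close> of \<open>y\<close>.\<close>
        moreover have "\<exists>w\<in>f ` ?B. dist w y < e" if e: "e > 0" for e
        proof -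
          obtain N where N: "finite N" "N \<subseteq> ?B" "\<And>x. x \<in> ?B \<Longrightarrow> \<exists>n\<in>N. dist n x < e / 2"
            using compact_finite_net[OF B, of "e / 2"] e by (metis half_gt_zero)
          let ?W = "{h. \<forall>n\<in>N. dist (f n) (h n) < e / 2}"
          have "open ?W" by (rule open_fun_near_on_finite[OF N(1)])
          moreover have "f \<in> ?W" using e by simp
          ultimately obtain h where h: "h \<in> ?S" "h \<in> ?W"
            using f open_Int_closure_eq_empty[of ?W ?S] by blast
          obtain x where x: "h x = y" using h(1) by (metis (mono_tags, lifting) Isom_iff mem_Collect_eq surjD)
          have hd: "dist (h u) (h v) = dist u v" for u v using h(1) by (simp add: Isom_iff)
          have "dist a x \<le> r + dist a y"
            using dist_triangle[of "h a" y a] hd[of a x] x h(1) by simp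
          then obtain n where n: "n \<in> N" "dist n x < e / 2" using N(3) by auto
          have "dist (f n) y \<le> dist (f n) (h n) + dist (h n) (h x)"
            using x dist_triangle by blast
          also have "\<dots> < e" using n h(2) hd[of n x] by force
          finally show ?thesis using n N(2) by blast
        qed
        ultimately have "y \<in> f ` ?B" by (metis closure_approachable closure_closed)
        then show ?thesis by blast
      qed
      then show ?thesis using d r by (auto simp: Isom_iff)
    qed
    then have "closure ?S \<subseteq> ?S" by (rule subsetI)
    then show ?thesis by (rule iffD1[OF closure_subset_eq])
  qed
  ultimately have "compact (?S \<inter> ?K)" "?S \<inter> ?K = ?S" by (blast intro: closed_Int_compact)+
  then show ?thesis by simp
qed

section \<open>Points with open stabiliser\<close>

text \<open>The hypotheses on \<open>G\<close> in terms of maps: \<open>inv_into UNIV\<close>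
  replaces the inverse of the monoid, and the topology is that of pointwise convergence.\<close>

locale closed_isometry_group =
  fixes G :: "('a::metric_space \<Rightarrow> 'a) set"
  assumes G_Isom: "G \<subseteq> Isom"
    and id_G: "id \<in> G"
    and comp_G: "\<And>g h. g \<in> G \<Longrightarrow> h \<in> G \<Longrightarrow> g \<circ> h \<in> G"
    and inv_G: "\<And>g. g \<in> G \<Longrightarrow> inv_into UNIV g \<in> G"
    and closed_G: "closedin (top_of_set Isom) G"
begin

lemma dist_G: "g \<in> G \<Longrightarrow> dist (g x) (g y) = dist x y"
  using G_Isom by (auto simp: Isom_iff)

lemma bij_G: "g \<in> G \<Longrightarrow> bij g"
  using G_Isom Isom_bij by blast

text \<open>Makes the basic neighbourhoods of the identity symmetric under inversion.\<close>

lemma dist_inv_G: "g \<in> G \<Longrightarrow> dist (inv_into UNIV g x) x = dist (g x) x"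
  using dist_G[of g "inv_into UNIV g x" x] bij_G[of g] by (simp add: bij_is_surj surj_f_inv_f dist_commute)

lemma compact_bounded_displacement:
  assumes P: "proper_space TYPE('a)"
  shows "compact {g \<in> G. dist (g a) a \<le> r}"
proof -
  obtain T where T: "closed T" "G = Isom \<inter> T" using closed_G unfolding closedin_closed by blast
  have "compact ({g \<in> Isom. dist (g a) a \<le> r} \<inter> T)"
    by (rule compact_Int_closed[OF compact_Isom_bounded_displacement[OF P] T(1)])
  also have "{g \<in> Isom. dist (g a) a \<le> r} \<inter> T = {g \<in> G. dist (g a) a \<le> r}"
    unfolding T(2) by blast
  finally show ?thesis .
qed

lemma open_bounded_displacement: "openin (top_of_set G) {g \<in> G. dist (g a) a < r}"
proof -
  have "{g \<in> G. dist (g a) a < r} = G \<inter> {g. \<forall>n\<in>{a}. dist (id n) (g n) < r}"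
    by (auto simp: dist_commute)
  then show ?thesis using open_fun_near_on_finite[of "{a}" id r] by (simp add: openin_open_Int)
qed

section \<open>Compact open neighbourhoods of the identity\<close>

lemma locally_compact:
  assumes P: "proper_space TYPE('a)"
  shows "locally_compact_space (top_of_set G)"
  unfolding locally_compact_space_def
proof
  fix g assume "g \<in> topspace (top_of_set G)"
  then have g: "g \<in> G" by simp
  \<comment> \<open>This only names a base point.\<close>
  obtain a :: 'a where True by blast
  let ?r = "dist (g a) a + 1"
  have "compactin (top_of_set G) {g \<in> G. dist (g a) a \<le> ?r}"
    using compact_bounded_displacement[OF P] by (auto simp: compactin_subtopology)
  then show "\<exists>U K. openin (top_of_set G) U \<and> compactin (top_of_set G) K \<and> g \<in> U \<and> U \<subseteq> K"
    using open_bounded_displacement[of a ?r] g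
    by (intro exI[of _ "{g \<in> G. dist (g a) a < ?r}"] exI[of _ "{g \<in> G. dist (g a) a \<le> ?r}"]) auto
qed

lemma Hausdorff: "Hausdorff_space (top_of_set G)"
proof -
  have "Hausdorff_space (euclidean :: ('a \<Rightarrow> 'a) topology)"
    unfolding euclidean_product_topology[symmetric] by (simp add: Hausdorff_space_product_topology)
  then show ?thesis by (rule Hausdorff_space_subtopology)
qed

text \<open>In a locally compact Hausdorff space a compact component has clopen neighbourhoods
  inside any open set containing it. Here the component is \<open>{id}\<close>, and the bound on
  displacements makes the clopen set compact.\<close>

lemma compact_open_neighbourhood_id:
  assumes P: "proper_space TYPE('a)" and T: "totally_disconnected_space (top_of_set G)"
  obtains K where "compact K" "openin (top_of_set G) K" "id \<in> K" "\<And>g. g \<in> K \<Longrightarrow> dist (g a) a \<le> 1"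
proof -
  have "connected_component_of_set (top_of_set G) id = {id}"
    using T id_G by (simp add: totally_disconnected_space_def)
  then have "{id} \<in> connected_components_of (top_of_set G)"
    using id_G by (metis connected_component_in_connected_components_of topspace_euclidean_subtopology)
  moreover have "compactin (top_of_set G) {id}" using id_G by simp
  moreover have "{id} \<subseteq> {g \<in> G. dist (g a) a < 1}" using id_G by simp
  ultimately obtain U V where "openin (top_of_set G) U" "openin (top_of_set G) V" "disjnt U V"
      "U \<union> V = topspace (top_of_set G)" "{id} \<subseteq> U" "U \<subseteq> {g \<in> G. dist (g a) a < 1}"
    by (rule wilder_locally_compact_component_thm
        [OF locally_compact[OF P] Hausdorff _ _ open_bounded_displacement[of a 1]])
  then have U: "openin (top_of_set G) U" "openin (top_of_set G) V" "disjnt U V"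
      "U \<union> V = G" "id \<in> U" "U \<subseteq> {g \<in> G. dist (g a) a < 1}" by simp_all
  have "U = topspace (top_of_set G) - V" using U(3,4) by (auto simp: disjnt_def)
  then have "closedin (top_of_set G) U" using U(2) by blast
  then obtain W where W: "closed W" "U = G \<inter> W" unfolding closedin_closed by blast
  then have "U = {g \<in> G. dist (g a) a \<le> 1} \<inter> W" using U(6) by force
  then have "compact U" using compact_Int_closed[OF compact_bounded_displacement[OF P, of a 1] W(1)] by simp
  then show thesis using U by (intro that[of U]) force+
qed

text \<open>Right translation by \<open>u\<close> displaces every isometry \<open>k\<close> at \<open>n\<close> by exactly \<open>dist (u n) n\<close>,
  uniformly in \<open>k\<close>.\<close>

lemma compact_open_right_translates:
  assumes K: "compact K" "openin (top_of_set G) K"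
  obtains N e where "finite N" "e > 0"
    "\<And>k u. k \<in> K \<Longrightarrow> u \<in> G \<Longrightarrow> (\<forall>n\<in>N. dist (u n) n < e) \<Longrightarrow> k \<circ> u \<in> K"
proof -
  have KG: "K \<subseteq> G" using K(2) openin_imp_subset by blast
  obtain W where W: "open W" "K = G \<inter> W" using K(2) unfolding openin_open by blast
  have "\<exists>N e. finite N \<and> e > 0 \<and> (\<forall>h. (\<forall>n\<in>N. dist (k n) (h n) < e) \<longrightarrow> h \<in> W)" if "k \<in> K" for k
    using open_fun_near_on_finiteE[OF W(1), of k] that W(2) by (metis IntD2)
  then obtain N e where Ne: "\<And>k. k \<in> K \<Longrightarrow> finite (N k)" "\<And>k. k \<in> K \<Longrightarrow> e k > (0::real)"
    "\<And>k h. k \<in> K \<Longrightarrow> (\<forall>n\<in>N k. dist (k n) (h n) < e k) \<Longrightarrow> h \<in> W" by metis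
  \<comment> \<open>Half of the radius \<open>e k\<close> is spent on the cover; the other half is
    left for the translation by \<open>u\<close>.\<close>
  let ?V = "\<lambda>k. {h. \<forall>n\<in>N k. dist (k n) (h n) < e k / 2}"
  have cover: "K \<subseteq> (\<Union>k\<in>K. ?V k)" using Ne(2) by force
  have "open (?V k)" if "k \<in> K" for k by (rule open_fun_near_on_finite[OF Ne(1)[OF that]])
  then obtain F where F: "F \<subseteq> K" "finite F" "K \<subseteq> (\<Union>k\<in>F. ?V k)"
    using cover by (rule compactE_image[OF K(1)])
  define d where "d = Min (insert 1 ((\<lambda>k. e k / 2) ` F))"
  have d: "0 < d" "\<And>k. k \<in> F \<Longrightarrow> d \<le> e k / 2"
  proof -
    show "0 < d" unfolding d_def using F(1,2) Ne(2) by (subst Min_gr_iff) auto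
    show "d \<le> e k / 2" if "k \<in> F" for k
      unfolding d_def using F(2) that by (intro Min_le) auto
  qed
  show thesis
  proof (rule that)
    show "finite (\<Union>k\<in>F. N k)" using F Ne(1) by blast
    show "0 < d" by fact
    fix k u assume k: "k \<in> K" and u: "u \<in> G" "\<forall>n\<in>\<Union>k\<in>F. N k. dist (u n) n < d"
    obtain k' where k': "k' \<in> F" "k \<in> ?V k'" using F(3) k by blast
    have "dist (k' n) ((k \<circ> u) n) < e k'" if n: "n \<in> N k'" for n
    proof -
      have "dist (k' n) ((k \<circ> u) n) \<le> dist (k' n) (k n) + dist (k n) (k (u n))"
        using dist_triangle by auto
      also have "dist (k n) (k (u n)) = dist (u n) n" using dist_G KG k by (metis dist_commute subsetD)
      also have "dist (k' n) (k n) + dist (u n) n < e k'" using k' n u(2) d(2)[OF k'(1)] by force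
      finally show ?thesis .
    qed
    then have "k \<circ> u \<in> W" using Ne(3)[of k' "k \<circ> u"] k'(1) F(1) by blast
    then show "k \<circ> u \<in> K" using W(2) comp_G[OF _ u(1)] KG k by blast
  qed
qed

text \<open>Equivalently, the points whose stabiliser in \<open>G\<close> is open.\<close>

definition smooth_points :: "'a set" where
  "smooth_points = {x. \<exists>N e. finite N \<and> e > 0 \<and> (\<forall>g\<in>G. (\<forall>n\<in>N. dist (g n) n < e) \<longrightarrow> g x = x)}"

text \<open>A finite intersection of open stabilisers is open: unite the test sets and take the
  least tolerance.\<close>

lemma finite_smooth_points:
  assumes "finite X" "X \<subseteq> smooth_points"
  obtains N e where "finite N" "e > 0" "\<And>g x. g \<in> G \<Longrightarrow> (\<forall>n\<in>N. dist (g n) n < e) \<Longrightarrow> x \<in> X \<Longrightarrow> g x = x"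
proof -
  obtain N e where Ne: "\<And>x. x \<in> X \<Longrightarrow> finite (N x)" "\<And>x. x \<in> X \<Longrightarrow> e x > (0::real)"
    "\<And>x g. x \<in> X \<Longrightarrow> g \<in> G \<Longrightarrow> (\<forall>n\<in>N x. dist (g n) n < e x) \<Longrightarrow> g x = x"
    using assms(2) unfolding smooth_points_def subset_iff mem_Collect_eq by metis
  define d where "d = Min (insert 1 (e ` X))"
  have d: "0 < d" "\<And>x. x \<in> X \<Longrightarrow> d \<le> e x"
    unfolding d_def using assms(1) Ne(2) by auto
  show thesis
  proof (rule that[of "\<Union>x\<in>X. N x" d])
    fix g x assume "g \<in> G" "\<forall>n\<in>\<Union>x\<in>X. N x. dist (g n) n < d" "x \<in> X"
    then show "g x = x" using Ne(3)[of x g] d(2)[of x] by force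
  qed (use assms(1) Ne(1) d(1) in auto)
qed

lemma smooth_points_invariant:
  assumes g: "g \<in> G" shows "g ` smooth_points = smooth_points"
proof -
  have sub: "g x \<in> smooth_points" if g: "g \<in> G" and x: "x \<in> smooth_points" for g x
  proof -
    obtain N e where Ne: "finite N" "e > 0"
        "\<And>h. h \<in> G \<Longrightarrow> (\<forall>n\<in>N. dist (h n) n < e) \<Longrightarrow> h x = x"
      using x unfolding smooth_points_def by blast
    have gi: "g (inv_into UNIV g y) = y" "inv_into UNIV g (g y) = y" for y
      using bij_G[OF g] by (simp_all add: bij_is_surj bij_is_inj surj_f_inv_f)
    have "h (g x) = g x" if h: "h \<in> G" "\<forall>n\<in>g ` N. dist (h n) n < e" for h
    proof -
      have "dist (inv_into UNIV g (h (g n))) n = dist (h (g n)) (g n)" for n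
        using dist_G[OF g, of "inv_into UNIV g (h (g n))" n] by (simp add: gi)
      then have "(inv_into UNIV g \<circ> (h \<circ> g)) x = x"
        using h by (intro Ne(3) comp_G inv_G g) auto
      then show ?thesis by (metis comp_apply gi(1))
    qed
    then show ?thesis unfolding smooth_points_def using Ne(1,2)
      by (intro CollectI exI[of _ "g ` N"] exI[of _ e]) auto
  qed
  have "x \<in> g ` smooth_points" if "x \<in> smooth_points" for x
    using sub[OF inv_G[OF g] that] bij_G[OF g] by (metis bij_inv_eq_iff imageI)
  then show ?thesis using sub[OF g] by blast
qed

text \<open>One neighbourhood of the identity fixes both endpoints, and its fixed point set is
  convex.\<close>

lemma smooth_points_convex:
  assumes C: "CAT0_space TYPE('a)"
  shows "geodesically_convex smooth_points"
  unfolding geodesically_convex_def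
proof (intro ballI allI impI subsetI)
  fix x y S w assume xy: "x \<in> smooth_points" "y \<in> smooth_points" and S: "geodesic_segment x y S" "w \<in> S"
  obtain N e where Ne: "finite N" "e > 0"
      "\<And>g z. g \<in> G \<Longrightarrow> (\<forall>n\<in>N. dist (g n) n < e) \<Longrightarrow> z \<in> {x, y} \<Longrightarrow> g z = z"
    using finite_smooth_points[of "{x, y}"] xy by blast
  let ?U = "{g \<in> G. \<forall>n\<in>N. dist (g n) n < e}"
  have "geodesically_convex {z. \<forall>g\<in>?U. g z = z}"
    using closed_geodesically_convex_fixed_points(2)[OF C, of ?U] G_Isom by blast
  moreover have "x \<in> {z. \<forall>g\<in>?U. g z = z}" "y \<in> {z. \<forall>g\<in>?U. g z = z}" using Ne(3) by auto
  ultimately have "S \<subseteq> {z. \<forall>g\<in>?U. g z = z}"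
    using S(1) unfolding geodesically_convex_def by blast
  then have "\<forall>g\<in>?U. g w = w" using S(2) by blast
  then show "w \<in> smooth_points" unfolding smooth_points_def using Ne(1,2) by blast
qed

text \<open>Van Dantzig: the right stabiliser of a compact open neighbourhood of the identity is an open
  subgroup; it has a bounded orbit, whose circumcentre it fixes.\<close>

lemma smooth_points_nonempty:
  assumes C: "CAT0_space TYPE('a)" and P: "proper_space TYPE('a)"
    and T: "totally_disconnected_space (top_of_set G)"
  shows "smooth_points \<noteq> {}"
proof -
  obtain a :: 'a where True by blast
  obtain K where K: "compact K" "openin (top_of_set G) K" "id \<in> K" "\<And>g. g \<in> K \<Longrightarrow> dist (g a) a \<le> 1"
    using compact_open_neighbourhood_id[OF P T, of a] by blast
  obtain N e where Ne: "finite N" "e > 0"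
      "\<And>k u. k \<in> K \<Longrightarrow> u \<in> G \<Longrightarrow> (\<forall>n\<in>N. dist (u n) n < e) \<Longrightarrow> k \<circ> u \<in> K"
    using compact_open_right_translates[OF K(1,2)] by blast
  \<comment> \<open>Asking for \<open>u\<close> and its inverse makes \<open>H\<close> a group;
    \<open>id \<in> K\<close> gives \<open>H \<subseteq> K\<close>, which bounds the orbit of
    \<open>a\<close>.\<close>
  define H where "H = {u \<in> G. \<forall>k\<in>K. k \<circ> u \<in> K \<and> k \<circ> inv_into UNIV u \<in> K}"
  have HK: "u \<in> K" if "u \<in> H" for u
    using that K(3) unfolding H_def by (metis (mono_tags, lifting) id_comp mem_Collect_eq)
  have comp_H: "u \<circ> v \<in> H" if "u \<in> H" "v \<in> H" for u v
    using that comp_G bij_G unfolding H_def by (auto simp: o_inv_distrib bij_is_inj simp flip: comp_assoc)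
  have inv_H: "inv_into UNIV u \<in> H" if "u \<in> H" for u
    using that inv_G bij_G unfolding H_def by (auto simp: inv_inv_eq)
  have U_H: "u \<in> H" if u: "u \<in> G" "\<forall>n\<in>N. dist (u n) n < e" for u
    using Ne(3) u inv_G[OF u(1)] dist_inv_G[OF u(1)] unfolding H_def by simp
  let ?O = "(\<lambda>h. h a) ` H"
  have "?O \<subseteq> cball a 1" using K(4) HK by (auto simp: dist_commute)
  then have "bounded ?O" using bounded_cball bounded_subset by blast
  moreover have "id \<in> H" using U_H[of id] id_G Ne(2) by simp
  then have "?O \<noteq> {}" by blast
  ultimately obtain z where z: "\<And>g. g \<in> Isom \<Longrightarrow> g ` ?O = ?O \<Longrightarrow> g z = z"
    using CAT0_bounded_set_center[OF C P, of ?O] by blast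
  have "g z = z" if g: "g \<in> H" for g
  proof (rule z)
    have gG: "g \<in> G" using g H_def by blast
    then show "g \<in> Isom" using G_Isom by blast
    have "h a \<in> g ` ?O" if "h \<in> H" for h
    proof -
      have "h a = g ((inv_into UNIV g \<circ> h) a)" using bij_G[OF gG] by (simp add: bij_is_surj surj_f_inv_f)
      then show ?thesis using comp_H[OF inv_H[OF g] that] by blast
    qed
    moreover have "g (h a) \<in> ?O" if "h \<in> H" for h
      using comp_H[OF g that] by (metis comp_apply image_eqI)
    ultimately show "g ` ?O = ?O" by blast
  qed
  then have "z \<in> smooth_points" unfolding smooth_points_def using U_H Ne(1,2) by blast
  then show ?thesis by blast
qed

section \<open>From density to open stabilisers\<close>

text \<open>This is openness of the stabiliser of \<open>B\<close> at the identity, with explicit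
  test points and tolerance.\<close>

lemma bounded_set_uniformly_fixed:
  assumes C: "CAT0_space TYPE('a)" and P: "proper_space TYPE('a)"
    and E: "geodesically_complete TYPE('a)"
    and T: "totally_disconnected_space (top_of_set G)" and M: "minimal_action G"
    and B: "bounded B"
  obtains N e where "finite N" "e > 0"
    "\<And>g x. g \<in> G \<Longrightarrow> (\<forall>n\<in>N. dist (g n) n < e) \<Longrightarrow> x \<in> B \<Longrightarrow> g x = x"
proof -
  have "g ` closure smooth_points = closure smooth_points" if g: "g \<in> G" for g
  proof -
    have sub: "g ` closure smooth_points \<subseteq> closure smooth_points" if g: "g \<in> G" for g
    proof (rule image_closure_subset)
      show "continuous_on (closure smooth_points) g" unfolding continuous_on_iff using dist_G[OF g] by auto
      show "g ` smooth_points \<subseteq> closure smooth_points"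
        using smooth_points_invariant[OF g] closure_subset by blast
    qed simp
    have "x \<in> g ` closure smooth_points" if "x \<in> closure smooth_points" for x
      using sub[OF inv_G[OF g]] that bij_G[OF g]
      by (metis bij_inv_eq_iff image_subset_iff imageI)
    then show ?thesis using sub[OF g] by blast
  qed
  moreover have "closure smooth_points \<noteq> {}" using smooth_points_nonempty[OF C P T] by simp
  moreover have "geodesically_convex (closure smooth_points)"
    by (rule geodesically_convex_closure[OF C smooth_points_convex[OF C]])
  ultimately have dense: "closure smooth_points = UNIV"
    using M unfolding minimal_action_def by blast
  obtain a r where r: "B \<subseteq> cball a r" using B bounded_subset_cball by blast
  \<comment> \<open>The net covers the larger ball because the projection argument loses 1 in the
    radius.\<close>
  have "compact (cball a (r + 1))" using P by (simp add: proper_space_def)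
  moreover have "cball a (r + 1) \<subseteq> (\<Union>f\<in>smooth_points. ball f 1)"
    using dense closure_approachable[of _ smooth_points] by force
  ultimately obtain X where X: "X \<subseteq> smooth_points" "finite X" "cball a (r + 1) \<subseteq> (\<Union>f\<in>X. ball f 1)"
    using compactE_image[of "cball a (r + 1)" smooth_points "\<lambda>f. ball f 1"] by auto
  obtain N e where Ne: "finite N" "e > 0"
      "\<And>g x. g \<in> G \<Longrightarrow> (\<forall>n\<in>N. dist (g n) n < e) \<Longrightarrow> x \<in> X \<Longrightarrow> g x = x"
    using finite_smooth_points[OF X(2,1)] by blast
  let ?U = "{g \<in> G. \<forall>n\<in>N. dist (g n) n < e}"
  have U: "?U \<subseteq> Isom" using G_Isom by blast
  have "cball a r \<subseteq> {x. \<forall>g\<in>?U. g x = x}"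
  proof (rule convex_meeting_unit_balls_contains_cball[OF C P E closed_geodesically_convex_fixed_points[OF C U]])
    fix y assume "y \<in> cball a (r + 1)"
    then obtain f where "f \<in> X" "dist f y < 1" using X(3) by auto
    then show "\<exists>q\<in>{x. \<forall>g\<in>?U. g x = x}. dist q y < 1" using Ne(3) by blast
  qed
  then show thesis using r by (intro that[OF Ne(1,2)]) blast
qed

text \<open>Openness at the identity spreads by translation: if \<open>h\<close> is close to
  \<open>g\<close> on \<open>N\<close>, then \<open>g\<close> inverse composed with \<open>h\<close>
  is close to the identity, so it fixes \<open>B\<close>, and \<open>h\<close> agrees with
  \<open>g\<close> there.\<close>

lemma open_pointwise_stabiliser:
  assumes "finite N" "e > 0"
    and fixed: "\<And>g x. g \<in> G \<Longrightarrow> (\<forall>n\<in>N. dist (g n) n < e) \<Longrightarrow> x \<in> B \<Longrightarrow> g x = x"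
  shows "openin (top_of_set G) (pointwise_stabiliser G B)"
proof (subst openin_subopen, intro ballI)
  fix g assume "g \<in> pointwise_stabiliser G B"
  then have g: "g \<in> G" "\<And>x. x \<in> B \<Longrightarrow> g x = x" by (auto simp: pointwise_stabiliser_def)
  have gi: "g (inv_into UNIV g y) = y" for y
    using bij_G[OF g(1)] by (simp add: bij_is_surj surj_f_inv_f)
  let ?W = "{h. \<forall>n\<in>N. dist (g n) (h n) < e}"
  have "h x = x" if h: "h \<in> G" "h \<in> ?W" and x: "x \<in> B" for h x
  proof -
    have "dist (inv_into UNIV g (h n)) n = dist (g n) (h n)" for n
      using dist_G[OF g(1), of "inv_into UNIV g (h n)" n] by (simp add: gi dist_commute)
    then have "(inv_into UNIV g \<circ> h) x = x" using h x by (intro fixed comp_G inv_G g) auto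
    then show ?thesis by (metis comp_apply gi g(2)[OF x])
  qed
  then have "G \<inter> ?W \<subseteq> pointwise_stabiliser G B" by (auto simp: pointwise_stabiliser_def)
  moreover have "openin (top_of_set G) (G \<inter> ?W)"
    by (rule openin_open_Int[OF open_fun_near_on_finite[OF assms(1)]])
  moreover have "g \<in> G \<inter> ?W" using g(1) assms(2) by simp
  ultimately show "\<exists>T. openin (top_of_set G) T \<and> g \<in> T \<and> T \<subseteq> pointwise_stabiliser G B" by blast
qed

end

lemma closed_isometry_groupI:
  fixes G :: "('a::metric_space \<Rightarrow> 'a) set"
  assumes "subgroup G isometry_group" "closedin isometry_topology G"
  shows "closed_isometry_group G"
proof
  interpret group "isometry_group :: ('a \<Rightarrow> 'a) monoid" by (rule group_isometry_group)
  interpret subgroup G isometry_group by fact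
  show sub: "G \<subseteq> Isom" using subset by (simp add: isometry_group_def)
  show "id \<in> G" using one_closed by (simp add: isometry_group_def)
  show "g \<circ> h \<in> G" if "g \<in> G" "h \<in> G" for g h
    using m_closed[OF that] by (simp add: isometry_group_def)
  show "inv_into UNIV g \<in> G" if g: "g \<in> G" for g
  proof -
    have "m_inv isometry_group g \<circ> g = id"
      using l_inv[of g] g sub by (auto simp: isometry_group_def)
    \<comment> \<open>A left inverse of a bijection is its inverse map.\<close>
    then have "m_inv isometry_group g = inv_into UNIV g"
      using g sub Isom_bij[of g] by (metis bij_is_surj comp_id fun.map_comp id_comp surj_iff subsetD comp_assoc)
    then show ?thesis using m_inv_closed[OF g] by simp
  qed
  show "closedin (top_of_set Isom) G" using assms(2) by (simp add: isometry_topology_eq)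
qed

theorem theorem1p2:
  fixes G :: "('a::metric_space \<Rightarrow> 'a) set"
  assumes "CAT0_space TYPE('a)"
    and "proper_space TYPE('a)"
    and "geodesically_complete TYPE('a)"
    and "subgroup G isometry_group"
    and "closedin isometry_topology G"
    and "totally_disconnected_space (subtopology isometry_topology G)"
    and "minimal_action G"
  shows "\<forall>B. bounded B \<longrightarrow>
           openin (subtopology isometry_topology G) (pointwise_stabiliser G B)"
proof (intro allI impI)
  fix B :: "'a set" assume B: "bounded B"
  interpret closed_isometry_group G by (rule closed_isometry_groupI) fact+
  have top: "subtopology isometry_topology G = top_of_set G"
    using G_Isom by (simp add: isometry_topology_eq subtopology_subtopology inf.absorb2)
  obtain N e where "finite N" "e > 0"
      "\<And>g x. g \<in> G \<Longrightarrow> (\<forall>n\<in>N. dist (g n) n < e) \<Longrightarrow> x \<in> B \<Longrightarrow> g x = x"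
    using bounded_set_uniformly_fixed[OF assms(1-3) assms(6)[unfolded top] assms(7) B] by blast
  then show "openin (subtopology isometry_topology G) (pointwise_stabiliser G B)"
    unfolding top by (rule open_pointwise_stabiliser)
qed
end
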